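(* $\gamma^{L-ID}(\mathcal{K})=\frac29$: every local identifying code in the king grid has density at least $2/9$, and there is a local identifying code in the king grid of density $2/9$.
   Context: The king grid $\mathcal{K}$ has vertex set $\mathbb{Z}^2$, with $\mathbf{u},\mathbf{v}$ adjacent iff $\mathbf{u}-\mathbf{v}\in\{(\pm1,0),(0,\pm1),(\pm1,\pm1)\}$. For a nonempty $C\subseteq\mathbb{Z}^2$ and vertex $\mathbf{u}$, $I(\mathbf{u})=N[\mathbf{u}]\cap C$ where $N[\mathbf{u}]$ is the closed neighbourhood. $C$ is a local identifying code if $I(\mathbf{u})\ne\emptyset$ for all $\mathbf{u}$ and $I(\mathbf{u})\ne I(\mathbf{v})$ for all adjacent $\mathbf{u},\mathbf{v}$. The density of $C$ is $D(C)=\limsup_{n\to\infty}|C\cap Q_n|/|Q_n|$ with $Q_n=\{(i,j)\in\mathbb{Z}^2:|i|\le n,|j|\le n\}$. $\gamma^{L-ID}(G)$ denotes the smallest density of a local identifying code in $G$. *)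

theory Defs
  imports "HOL-Analysis.Analysis"
begin

definition king_adj :: "int \<times> int \<Rightarrow> int \<times> int \<Rightarrow> bool" where
  "king_adj u v \<longleftrightarrow> u \<noteq> v \<and> \<bar>fst u - fst v\<bar> \<le> 1 \<and> \<bar>snd u - snd v\<bar> \<le> 1"

definition king_closed_nbhd :: "int \<times> int \<Rightarrow> (int \<times> int) set" where
  "king_closed_nbhd u = {v. v = u \<or> king_adj u v}"

definition I_set :: "(int \<times> int) set \<Rightarrow> int \<times> int \<Rightarrow> (int \<times> int) set" where
  "I_set C u = king_closed_nbhd u \<inter> C"

definition local_identifying_code :: "(int \<times> int) set \<Rightarrow> bool" where
  "local_identifying_code C \<longleftrightarrow> C \<noteq> {} \<and>
     (\<forall>u. I_set C u \<noteq> {}) \<and>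
     (\<forall>u v. king_adj u v \<longrightarrow> I_set C u \<noteq> I_set C v)"

definition Qbox :: "nat \<Rightarrow> (int \<times> int) set" where
  "Qbox n = {(i, j). \<bar>i\<bar> \<le> int n \<and> \<bar>j\<bar> \<le> int n}"

definition density :: "(int \<times> int) set \<Rightarrow> ereal" where
  "density C = limsup (\<lambda>n. ereal (real (card (C \<inter> Qbox n)) / real (card (Qbox n))))"

definition gamma_LID_king :: ereal where
  "gamma_LID_king = Inf {density C | C. local_identifying_code C}"

end

(*
  Every codeword lies in exactly nine closed neighbourhoods, so the lower bound says that |I(v)| is
  at least 2 on average.  Each vertex v distributes a total charge of at most |I(v)| - 2 over the
  codewords in I(v).  The rule depends only on the shape of I(v) and is chosen such that every
  codeword c receives a nonnegative total.  This total depends only on the code in the 5 x 5 square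
  around c.  It can be negative only if some u in N[c] has I(u) = {c}, and once u is fixed, the
  remaining 16 cells of the square are settled by a branch-and-bound search.  A code with period
  6 x 6 and eight codewords per period attains the bound.
*)

theory Submission
  imports Defs "HOL-Real_Asymp.Real_Asymp"
begin

section \<open>The charging rule\<close>

definition near :: "int \<times> int \<Rightarrow> int \<times> int \<Rightarrow> bool" where
  "near u v \<longleftrightarrow> \<bar>fst u - fst v\<bar> \<le> 1 \<and> \<bar>snd u - snd v\<bar> \<le> 1"

text \<open>Within a closed neighbourhood coordinates differ by at most 2, so there this is
  king distance 2.\<close>

definition far :: "int \<times> int \<Rightarrow> int \<times> int \<Rightarrow> bool" where
  "far u v \<longleftrightarrow> \<bar>fst u - fst v\<bar> = 2 \<or> \<bar>snd u - snd v\<bar> = 2"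

lemma near_commute: "near u v \<longleftrightarrow> near v u"
  by (auto simp: near_def)

lemma far_commute: "far u v \<longleftrightarrow> far v u"
  by (auto simp: far_def)

lemma not_far_self [simp]: "\<not> far u u"
  by (simp add: far_def)

lemma I_set_eq: "I_set C u = {v \<in> C. near u v}"
  by (auto simp: I_set_def king_closed_nbhd_def king_adj_def near_def)

text \<open>The share of \<open>c\<close> in a triple, read off from the graph of far pairs: a
  single far pair gives 3 to each end, a path gives 6 to its middle, a triangle gives 2 to everyone.
  Being free of sets and cardinalities, it can be evaluated directly in the search.\<close>

definition gift3 :: "int \<times> int \<Rightarrow> int \<times> int \<Rightarrow> int \<times> int \<Rightarrow> int" where
  "gift3 c x y = (if far x y then if far c x \<and> far c y then 2 else 0
     else if far c x then if far c y then 6 else 3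
     else if far c y then 3 else 0)"

text \<open>The charge, in units of 1/6, that a vertex \<open>v\<close> with \<open>I(v) = K\<close> gives to \<open>c \<in> K\<close>. If \<open>K\<close> has three
  elements, the surplus 6 goes in equal shares to those that are far from the largest number of
  others, and to nobody if no two are far apart.\<close>

definition gift :: "(int \<times> int) set \<Rightarrow> int \<times> int \<Rightarrow> int" where
  "gift K c =
     (if card K \<le> 1 then - 6
      else if card K = 2 then 0
      else if card K = 3 then
        if \<exists>x \<in> K - {c}. \<exists>y \<in> K - {c}. far x y
        then if card {x \<in> K. far c x} = 2 then 2 else 0
        else 3 * int (card {x \<in> K. far c x})
      else 3)"

lemma gift_triple:
  assumes "c \<noteq> x" "c \<noteq> y" "x \<noteq> y"
  shows "gift {c, x, y} c = gift3 c x y"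
proof -
  have "(\<exists>a \<in> {c, x, y} - {c}. \<exists>b \<in> {c, x, y} - {c}. far a b) \<longleftrightarrow> far x y"
    using assms by (auto simp: far_commute)
  moreover have "{a \<in> {c, x, y}. far c a} = (if far c x then {x} else {}) \<union> (if far c y then {y} else {})"
    by auto
  ultimately show ?thesis
    using assms by (simp add: gift_def gift3_def)
qed

lemma gift_nonneg: "2 \<le> card K \<Longrightarrow> 0 \<le> gift K c"
  by (simp add: gift_def)

lemma gift_ge: "- 6 \<le> gift K c"
  by (simp add: gift_def)

lemma gift_eq_3: "4 \<le> card K \<Longrightarrow> gift K c = 3"
  by (simp add: gift_def)

lemma card_3_pivot:
  assumes "card K = 3" "c \<in> K"
  obtains x y where "K = {c, x, y}" "c \<noteq> x" "c \<noteq> y" "x \<noteq> y"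
proof -
  have "card (K - {c}) = 2"
    using assms by (simp add: card_Diff_singleton)
  then obtain x y where "K - {c} = {x, y}" "x \<noteq> y"
    by (auto simp: card_2_iff)
  then show ?thesis
    using assms(2) by (intro that[of x y]) auto
qed

lemma gift_le_6:
  assumes "c \<in> K"
  shows "gift K c \<le> 6"
proof (cases "card K = 3")
  case True
  then obtain x y where "K = {c, x, y}" "c \<noteq> x" "c \<noteq> y" "x \<noteq> y"
    using assms by (rule card_3_pivot)
  then show ?thesis
    by (simp add: gift_triple gift3_def)
qed (simp add: gift_def)

text \<open>A triple shares out 6 or nothing. From four elements on everyone gets 3, and 3 * k \<le>
  6 * (k - 2) holds exactly when k \<ge> 4.\<close>

lemma sum_gift_le:
  assumes "finite K" "K \<noteq> {}"
  shows "(\<Sum>c \<in> K. gift K c) \<le> 6 * (int (card K) - 2)"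
proof -
  have "card K \<noteq> 0"
    using assms by simp
  then consider "card K = 1" | "card K = 2" | "card K = 3" | "4 \<le> card K"
    by linarith
  then show ?thesis
  proof cases
    case 3
    then obtain x y z where K: "K = {x, y, z}" "x \<noteq> y" "x \<noteq> z" "y \<noteq> z"
      by (auto simp: card_3_iff)
    have "gift K x = gift3 x y z" "gift K y = gift3 y x z" "gift K z = gift3 z x y"
      using K gift_triple[of x y z] gift_triple[of y x z] gift_triple[of z x y]
      by (simp_all add: insert_commute)
    then have "(\<Sum>c \<in> K. gift K c) = gift3 x y z + gift3 y x z + gift3 z x y"
      using K by simp
    also have "\<dots> \<le> 6"
      by (simp add: gift3_def far_commute)
    finally show ?thesis
      using 3 by simp
  qed (simp_all add: gift_def)
qed

lemma gift_translate: "gift ((+) d ` K) (d + c) = gift K c"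
proof -
  have far: "far (d + x) (d + y) \<longleftrightarrow> far x y" for x y
    by (simp add: far_def)
  have "{x \<in> (+) d ` K. far (d + c) x} = (+) d ` {x \<in> K. far c x}"
    by (simp add: Compr_image_eq far)
  moreover have "(+) d ` K - {d + c} = (+) d ` (K - {c})"
    by (auto simp del: add_Pair)
  ultimately show ?thesis
    by (simp add: gift_def card_image far)
qed

subsection \<open>The 5 x 5 square around a codeword\<close>

text \<open>A view \<open>(K, U)\<close> is partial knowledge of \<open>I(v)\<close> for a neighbour \<open>v\<close> of the codeword \<open>(0, 0)\<close>: besides
  \<open>(0, 0)\<close> it contains \<open>K\<close>, and all its other elements are among the undecided cells \<open>U\<close>.\<close>

type_synonym view = "(int \<times> int) list \<times> (int \<times> int) list"

definition view_set :: "(int \<times> int) set \<Rightarrow> view \<Rightarrow> (int \<times> int) set" where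
  "view_set S w = insert (0, 0) (set (fst w) \<union> set (snd w) \<inter> S)"

text \<open>Distinctness makes list lengths count codewords and lets \<open>remove1\<close> delete a
  cell completely.\<close>

definition wf_view :: "view \<Rightarrow> bool" where
  "wf_view w \<longleftrightarrow> distinct ((0, 0) # fst w @ snd w)"

fun view_bound :: "view \<Rightarrow> int" where
  "view_bound ([], U) = - 6"
| "view_bound ([x], U) = 0"
| "view_bound ([x, y], U) = (if U = [] then gift3 (0, 0) x y else min 3 (gift3 (0, 0) x y))"
| "view_bound (x # y # z # K, U) = 3"

lemma card_view_set:
  assumes "wf_view w"
  shows "card (view_set S w) = Suc (length (fst w) + card (set (snd w) \<inter> S))"
proof -
  have "card (set (fst w) \<union> set (snd w) \<inter> S) = length (fst w) + card (set (snd w) \<inter> S)"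
    using assms by (subst card_Un_disjoint) (auto simp: wf_view_def distinct_card)
  then show ?thesis
    using assms by (subst view_set_def, subst card_insert_disjoint) (auto simp: wf_view_def)
qed

text \<open>The bound is the worst case over all completions, and the origin always counts as one
  codeword. With one known cell there are at least two codewords. With two, the set either stays
  this triple or grows to at least four elements, where the gift is 3; hence \<open>min 3\<close>.
  With three known cells the gift is already fixed.\<close>

lemma view_bound_le:
  assumes "wf_view w"
  shows "view_bound w \<le> gift (view_set S w) (0, 0)"
proof (cases w rule: view_bound.cases)
  case (1 U)
  then show ?thesis
    by (simp add: gift_ge)
next
  case (2 x U)
  then show ?thesis
    using card_view_set[OF assms, of S] by (simp add: gift_nonneg)
next
  case (3 x y U)
  show ?thesis
  proof (cases "set U \<inter> S = {}")
    case True
    then show ?thesis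
      using 3 assms gift_triple[of "(0, 0)" x y] by (auto simp: view_set_def wf_view_def)
  next
    case False
    then have "1 \<le> card (set U \<inter> S)"
      by (simp add: Suc_le_eq card_gt_0_iff)
    then have "4 \<le> card (view_set S w)"
      using 3 card_view_set[OF assms, of S] by simp
    then show ?thesis
      using 3 False by (auto simp: gift_eq_3)
  qed
next
  case (4 x y z K U)
  then show ?thesis
    using card_view_set[OF assms, of S] by (simp add: gift_eq_3)
qed

section \<open>Branch-and-bound over the undecided cells\<close>

definition view_add :: "int \<times> int \<Rightarrow> view \<Rightarrow> view" where
  "view_add e w = (if e \<in> set (snd w) then (e # fst w, remove1 e (snd w)) else w)"

definition view_drop :: "int \<times> int \<Rightarrow> view \<Rightarrow> view" where
  "view_drop e w = (fst w, remove1 e (snd w))"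

lemma view_set_add: "wf_view w \<Longrightarrow> e \<in> S \<Longrightarrow> view_set S (view_add e w) = view_set S w"
  by (auto simp: view_set_def view_add_def wf_view_def)

lemma view_set_drop: "wf_view w \<Longrightarrow> e \<notin> S \<Longrightarrow> view_set S (view_drop e w) = view_set S w"
  by (auto simp: view_set_def view_drop_def wf_view_def)

lemma wf_view_add: "wf_view w \<Longrightarrow> wf_view (view_add e w)"
  by (auto simp: view_add_def wf_view_def)

lemma wf_view_drop: "wf_view w \<Longrightarrow> wf_view (view_drop e w)"
  by (auto simp: view_drop_def wf_view_def)

text \<open>The clauses \<open>Ds\<close> are sets of cells that the code must meet. A cell that is put into the code
  satisfies the clauses containing it, and a cell that is left out is deleted from them.\<close>

fun search :: "(int \<times> int) list list \<Rightarrow> view list \<Rightarrow> (int \<times> int) list \<Rightarrow> bool" where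
  "search Ds ws [] \<longleftrightarrow> [] \<in> set Ds \<or> 0 \<le> sum_list (map view_bound ws)"
| "search Ds ws (e # es) \<longleftrightarrow> [] \<in> set Ds \<or> 0 \<le> sum_list (map view_bound ws) \<or>
     search (filter (\<lambda>D. e \<notin> set D) Ds) (map (view_add e) ws) es \<and>
     search (map (removeAll e) Ds) (map (view_drop e) ws) es"

text \<open>The induction follows the branch that \<open>S\<close> itself takes at each cell.
  Deciding a cell in accordance with \<open>S\<close> changes no \<open>view_set\<close> and leaves
  every clause met by \<open>S\<close>. So a leaf with an empty clause is never reached, and any
  other leaf is closed by \<open>view_bound_le\<close>.\<close>

lemma search_sound:
  assumes "search Ds ws es"
    and "\<And>D. D \<in> set Ds \<Longrightarrow> set D \<inter> S \<noteq> {}"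
    and "\<And>w. w \<in> set ws \<Longrightarrow> wf_view w"
  shows "0 \<le> (\<Sum>w \<leftarrow> ws. gift (view_set S w) (0, 0))"
  using assms
proof (induction es arbitrary: Ds ws)
  have leaf: "0 \<le> (\<Sum>w \<leftarrow> ws. gift (view_set S w) (0, 0))"
    if "0 \<le> sum_list (map view_bound ws)" "\<And>w. w \<in> set ws \<Longrightarrow> wf_view w" for ws
    using that(1) sum_list_mono[of ws view_bound "\<lambda>w. gift (view_set S w) (0, 0)"]
      that(2) view_bound_le by fastforce
  {
    case Nil
    then show ?case
      using leaf by fastforce
  next
    case (Cons e es)
    have "[] \<notin> set Ds"
      using Cons.prems(2) by fastforce
    then consider "0 \<le> sum_list (map view_bound ws)"
      | "search (filter (\<lambda>D. e \<notin> set D) Ds) (map (view_add e) ws) es"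
        "search (map (removeAll e) Ds) (map (view_drop e) ws) es"
      using Cons.prems(1) by auto
    then show ?case
    proof cases
      case 1
      then show ?thesis
        using Cons.prems(3) by (rule leaf)
    next
      case 2
      show ?thesis
      proof (cases "e \<in> S")
        case True
        have "0 \<le> (\<Sum>w \<leftarrow> map (view_add e) ws. gift (view_set S w) (0, 0))"
          using 2(1) Cons.prems by (intro Cons.IH) (auto simp: wf_view_add)
        also have "\<dots> = (\<Sum>w \<leftarrow> ws. gift (view_set S w) (0, 0))"
          using True Cons.prems(3) by (auto simp: view_set_add intro!: arg_cong[of _ _ sum_list])
        finally show ?thesis .
      next
        case False
        have "0 \<le> (\<Sum>w \<leftarrow> map (view_drop e) ws. gift (view_set S w) (0, 0))"
        proof (intro Cons.IH[OF 2(2)])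
          fix D assume "D \<in> set (map (removeAll e) Ds)"
          then obtain D' where "D' \<in> set Ds" "D = removeAll e D'"
            by auto
          then show "set D \<inter> S \<noteq> {}"
            using Cons.prems(2)[of D'] False by auto
        qed (use Cons.prems(3) in \<open>auto simp: wf_view_drop\<close>)
        also have "\<dots> = (\<Sum>w \<leftarrow> ws. gift (view_set S w) (0, 0))"
          using False Cons.prems(3) by (auto simp: view_set_drop intro!: arg_cong[of _ _ sum_list])
        finally show ?thesis .
      qed
    qed
  }
qed

section \<open>The search problem for a vertex that sees only the origin\<close>

definition grid :: "int \<Rightarrow> (int \<times> int) list" where
  "grid r = List.product [-r..r] [-r..r]"

text \<open>One clause for each adjacent pair \<open>v\<close>, \<open>w\<close>, listed once thanks
  to the lexicographic condition: some codeword separates them. Cells near \<open>u\<close> are left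
  out, since the only codeword there is the origin, which is near both \<open>v\<close> and
  \<open>w\<close>.\<close>

definition clauses :: "int \<times> int \<Rightarrow> (int \<times> int) list list" where
  "clauses u = [filter (\<lambda>e. near v e \<noteq> near w e \<and> \<not> near u e) (grid 2).
     v \<leftarrow> grid 1, w \<leftarrow> grid 1, near v w \<and> (fst v < fst w \<or> fst v = fst w \<and> snd v < snd w)]"

definition views :: "int \<times> int \<Rightarrow> view list" where
  "views u = map (\<lambda>v. ([], filter (\<lambda>e. near v e \<and> \<not> near u e) (grid 2))) (grid 1)"

text \<open>Any order of the cells would be sound. Starting close to \<open>u\<close> keeps the search tree small
  (about ten thousand nodes for all nine \<open>u\<close> together).\<close>

definition undecided :: "int \<times> int \<Rightarrow> (int \<times> int) list" where
  "undecided u = sort_key (\<lambda>e. (fst e - fst u) * (fst e - fst u) + (snd e - snd u) * (snd e - snd u))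
     (filter (\<lambda>e. \<not> near u e) (grid 2))"

lemma search_succeeds: "\<forall>u \<in> set (grid 1). search (clauses u) (views u) (undecided u)"
  by code_simp

lemma set_grid: "set (grid r) = {- r..r} \<times> {- r..r}"
  by (simp add: grid_def)

lemma distinct_grid: "distinct (grid r)"
  by (simp add: grid_def distinct_product)

lemma near_in_grid: "u \<in> set (grid r) \<Longrightarrow> near u v \<Longrightarrow> v \<in> set (grid (r + 1))"
  by (cases u; cases v) (auto simp: set_grid near_def)

lemma sum_gift_origin:
  assumes "(0, 0) \<in> S"
    and sep: "\<And>u v. king_adj u v \<Longrightarrow> I_set S u \<noteq> I_set S v"
  shows "0 \<le> (\<Sum>v \<in> set (grid 1). gift (I_set S v) (0, 0))"
proof (cases "\<exists>u \<in> set (grid 1). card (I_set S u) \<le> 1")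
  case True
  then obtain u where u: "u \<in> set (grid 1)" "card (I_set S u) \<le> 1"
    by blast
  have near0: "near v (0, 0)" if "v \<in> set (grid 1)" for v
    using that by (auto simp: set_grid near_def)
  have fin: "finite (I_set S u)"
    using near_in_grid[OF u(1)] by (intro finite_subset[OF _ finite_set[of "grid 2"]]) (auto simp: I_set_eq)
  have "(0, 0) \<in> I_set S u"
    using u(1) near0 assms(1) by (simp add: I_set_eq)
  then have "\<forall>e \<in> I_set S u. e = (0, 0)"
    using u(2) card_le_Suc0_iff_eq[OF fin] by (metis One_nat_def)
  then have Iu: "e = (0, 0)" if "e \<in> S" "near u e" for e
    using that unfolding I_set_eq by blast
  have "0 \<le> (\<Sum>w \<leftarrow> views u. gift (view_set S w) (0, 0))"
  proof (rule search_sound)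
    show "search (clauses u) (views u) (undecided u)"
      using search_succeeds u(1) by blast
  next
    fix D assume "D \<in> set (clauses u)"
    then obtain v w where vw: "v \<in> set (grid 1)" "w \<in> set (grid 1)" "near v w" "v \<noteq> w"
      and D: "D = filter (\<lambda>e. near v e \<noteq> near w e \<and> \<not> near u e) (grid 2)"
      by (auto simp: clauses_def split: if_splits)
    have "king_adj v w"
      using vw by (auto simp: king_adj_def near_def)
    then obtain e where e: "e \<in> S" "near v e \<noteq> near w e"
      using sep[of v w] by (auto simp: I_set_eq)
    then have "e \<in> set (grid 2)"
      using vw(1,2) near_in_grid[of v 1 e] near_in_grid[of w 1 e] by auto
    moreover have "\<not> near u e"
      using Iu[of e] e near0 vw(1,2) by metis
    ultimately show "set D \<inter> S \<noteq> {}"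
      using e D by auto
  next
    fix w assume "w \<in> set (views u)"
    then show "wf_view w"
      using near0[OF u(1)] distinct_grid by (auto simp: views_def wf_view_def)
  qed
  also have "\<dots> = (\<Sum>v \<leftarrow> grid 1. gift (I_set S v) (0, 0))"
  proof -
    \<comment> \<open>By \<open>Iu\<close>, the neighbourhood of \<open>u\<close> contributes only
      the origin, which \<open>view_set\<close> inserts anyway.\<close>
    have "view_set S ([], filter (\<lambda>e. near v e \<and> \<not> near u e) (grid 2)) = I_set S v"
      if "v \<in> set (grid 1)" for v
      using near0[OF that] Iu assms(1) near_in_grid[OF that] by (auto simp: view_set_def I_set_eq)
    then show ?thesis
      by (auto simp: views_def comp_def intro!: arg_cong[of _ _ sum_list])
  qed
  also have "\<dots> = (\<Sum>v \<in> set (grid 1). gift (I_set S v) (0, 0))"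
    by (simp add: sum_list_distinct_conv_sum_set distinct_grid)
  finally show ?thesis .
next
  case False
  then show ?thesis
    by (intro sum_nonneg gift_nonneg) (auto simp: not_le)
qed


subsection \<open>Lower bound on the density\<close>

lemma near_set_eq: "{v. near c v} = (+) c ` set (grid 1)"
proof
  show "{v. near c v} \<subseteq> (+) c ` set (grid 1)"
  proof
    fix v assume "v \<in> {v. near c v}"
    then have "v - c \<in> set (grid 1)" "v = c + (v - c)"
      by (auto simp: near_def set_grid mem_Times_iff)
    then show "v \<in> (+) c ` set (grid 1)"
      by blast
  qed
qed (auto simp: near_def set_grid mem_Times_iff)

lemma finite_near [simp]: "finite {v. near c v}"
  by (simp add: near_set_eq)

lemma card_near: "card {v. near c v} = 9"
  by (simp add: near_set_eq card_image set_grid)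

lemma finite_I_set [simp]: "finite (I_set C v)"
  by (rule finite_subset[OF _ finite_near[of v]]) (auto simp: I_set_eq)

lemma card_I_set_le: "card (I_set C v) \<le> 9"
  using card_mono[OF finite_near, of "I_set C v" v] by (auto simp: I_set_eq card_near)

lemma sum_gift_nonneg:
  assumes "local_identifying_code C" "c \<in> C"
  shows "0 \<le> (\<Sum>v | near c v. gift (I_set C v) c)"
proof -
  \<comment> \<open>The code shifted so that \<open>c\<close> becomes the origin, where the search
    result applies.\<close>
  define S where "S = {p. c + p \<in> C}"
  have near: "near (c + u) (c + v) \<longleftrightarrow> near u v" for u v
    by (simp add: near_def)
  have I: "I_set C (c + v) = (+) c ` I_set S v" for v
  proof (intro equalityI subsetI)
    fix p assume "p \<in> I_set C (c + v)"
    then have "p - c \<in> I_set S v"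
      using near[of v "p - c"] by (simp add: I_set_eq S_def)
    then show "p \<in> (+) c ` I_set S v"
      by (intro image_eqI[of _ _ "p - c"]) simp_all
  qed (auto simp: I_set_eq S_def near simp del: add_Pair)
  have "0 \<le> (\<Sum>v \<in> set (grid 1). gift (I_set S v) (0, 0))"
  proof (rule sum_gift_origin)
    show "(0, 0) \<in> S"
      using assms(2) by (simp add: S_def flip: zero_prod_def)
    fix u v assume "king_adj u v"
    then have "king_adj (c + u) (c + v)"
      by (simp add: king_adj_def)
    then have "I_set C (c + u) \<noteq> I_set C (c + v)"
      using assms(1) unfolding local_identifying_code_def by blast
    then show "I_set S u \<noteq> I_set S v"
      by (auto simp: I)
  qed
  also have "\<dots> = (\<Sum>v \<in> set (grid 1). gift (I_set C (c + v)) c)"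
    using gift_translate[of c _ "(0, 0)"] by (simp add: I flip: zero_prod_def)
  also have "\<dots> = (\<Sum>v | near c v. gift (I_set C v) c)"
    by (simp add: near_set_eq sum.reindex)
  finally show ?thesis .
qed

section \<open>Double counting over boxes\<close>

lemma Qbox_eq: "Qbox n = {- int n..int n} \<times> {- int n..int n}"
  by (auto simp: Qbox_def)

lemma finite_Qbox [simp]: "finite (Qbox n)"
  by (simp add: Qbox_eq)

lemma card_Qbox: "card (Qbox n) = (2 * n + 1)\<^sup>2"
  by (simp add: Qbox_eq card_cartesian_product power2_eq_square nat_add_distrib nat_mult_distrib)

lemma Qbox_mono: "m \<le> n \<Longrightarrow> Qbox m \<subseteq> Qbox n"
  by (auto simp: Qbox_def)

lemma near_Qbox: "near u v \<Longrightarrow> u \<in> Qbox n \<Longrightarrow> v \<in> Qbox (Suc n)"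
  by (cases u; cases v) (auto simp: near_def Qbox_def)

text \<open>Three nested boxes keep both sums complete: all neighbours of a codeword in
  \<open>A\<close> lie in \<open>B\<close>, so its total is nonnegative, and all codewords seen from
  \<open>Qbox n\<close> lie in \<open>A\<close>, so \<open>sum_gift_le\<close> applies
  there.\<close>

lemma card_code_Qbox_ge:
  assumes C: "local_identifying_code C"
  shows "12 * int (card (Qbox n)) \<le>
    54 * int (card (C \<inter> Qbox (Suc n))) + 54 * (int (card (Qbox (Suc (Suc n)))) - int (card (Qbox n)))"
proof -
  define A where "A = C \<inter> Qbox (Suc n)"
  define B where "B = Qbox (Suc (Suc n))"
  have fin: "finite A" "finite B"
    by (simp_all add: A_def B_def)
  have QB: "Qbox n \<subseteq> B"
    by (simp add: B_def Qbox_mono)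
  have I: "{c \<in> A. near c v} = I_set C v" if "v \<in> Qbox n" for v
    using near_Qbox[OF _ that] by (auto simp: A_def I_set_eq near_commute)
  have I': "{c \<in> A. near c v} \<subseteq> I_set C v" for v
    by (auto simp: A_def I_set_eq near_commute)
  have nonempty: "I_set C v \<noteq> {}" for v
    using C unfolding local_identifying_code_def by blast
  have "0 \<le> (\<Sum>c \<in> A. \<Sum>v | near c v. gift (I_set C v) c)"
    using sum_gift_nonneg[OF C] by (rule sum_nonneg) (simp add: A_def)
  also have "\<dots> = (\<Sum>c \<in> A. \<Sum>v | v \<in> B \<and> near c v. gift (I_set C v) c)"
  proof (intro sum.cong refl)
    fix c assume "c \<in> A"
    then show "{v. near c v} = {v. v \<in> B \<and> near c v}"
      by (auto simp: A_def B_def intro: near_Qbox)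
  qed
  also have "\<dots> = (\<Sum>v \<in> B. \<Sum>c | c \<in> A \<and> near c v. gift (I_set C v) c)"
    using fin by (rule sum.swap_restrict)
  also have "\<dots> = (\<Sum>v \<in> Qbox n. \<Sum>c | c \<in> A \<and> near c v. gift (I_set C v) c)
      + (\<Sum>v \<in> B - Qbox n. \<Sum>c | c \<in> A \<and> near c v. gift (I_set C v) c)"
    by (subst sum.subset_diff[OF QB fin(2)]) (rule add.commute)
  \<comment> \<open>A rim vertex serves at most nine codewords with at most 6 each, hence 54. The
    rim has only linearly many vertices and vanishes in the limit.\<close>
  also have "\<dots> \<le> (\<Sum>v \<in> Qbox n. 6 * (int (card (I_set C v)) - 2)) + (\<Sum>v \<in> B - Qbox n. 54)"
  proof (intro add_mono sum_mono)
    show "(\<Sum>c | c \<in> A \<and> near c v. gift (I_set C v) c) \<le> 6 * (int (card (I_set C v)) - 2)"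
      if "v \<in> Qbox n" for v
      using I[OF that] sum_gift_le[of "I_set C v"] nonempty by simp
    show "(\<Sum>c | c \<in> A \<and> near c v. gift (I_set C v) c) \<le> 54" for v
    proof -
      have "(\<Sum>c | c \<in> A \<and> near c v. gift (I_set C v) c) \<le> of_nat (card {c \<in> A. near c v}) * 6"
        using I'[of v] by (intro sum_bounded_above gift_le_6) auto
      also have "card {c \<in> A. near c v} \<le> 9"
        using card_mono[OF finite_I_set I'[of v]] card_I_set_le[of C v] by simp
      finally show ?thesis
        by simp
    qed
  qed
  also have "(\<Sum>v \<in> Qbox n. 6 * (int (card (I_set C v)) - 2))
      = 6 * (\<Sum>v \<in> Qbox n. int (card (I_set C v))) - 12 * int (card (Qbox n))"
    by (simp add: right_diff_distrib sum_subtractf sum_distrib_left)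
  also have "(\<Sum>v \<in> Qbox n. int (card (I_set C v))) = (\<Sum>v \<in> Qbox n. \<Sum>c | c \<in> A \<and> near c v. 1)"
    by (intro sum.cong refl) (simp add: I)
  also have "\<dots> = (\<Sum>c \<in> A. \<Sum>v | v \<in> Qbox n \<and> near c v. 1)"
    using fin by (intro sum.swap_restrict[symmetric]) auto
  also have "\<dots> \<le> (\<Sum>c \<in> A. 9)"
  proof (intro sum_mono)
    fix c
    have "card {v. v \<in> Qbox n \<and> near c v} \<le> card {v. near c v}"
      by (intro card_mono) auto
    then show "(\<Sum>v | v \<in> Qbox n \<and> near c v. 1) \<le> (9 :: int)"
      by (simp add: card_near)
  qed
  finally have "0 \<le> 54 * int (card A) - 12 * int (card (Qbox n)) + 54 * int (card (B - Qbox n))"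
    by simp
  moreover have "int (card (B - Qbox n)) = int (card B) - int (card (Qbox n))"
    using QB fin(2) by (simp add: card_Diff_subset card_mono of_nat_diff)
  ultimately show ?thesis
    by (simp add: A_def B_def)
qed

lemma density_code_ge:
  assumes "local_identifying_code C"
  shows "ereal (2 / 9) \<le> density C"
proof -
  \<comment> \<open>The counting bound at \<open>n - 1\<close>, so that the code is counted in
    \<open>Qbox n\<close>; the boxes have sides 2n - 1, 2n + 1 and 2n + 3. The limit is
    12/54.\<close>
  define f where "f n = (12 * (2 * real n - 1)\<^sup>2 - 54 * ((2 * real n + 3)\<^sup>2 - (2 * real n - 1)\<^sup>2))
    / (54 * (2 * real n + 1)\<^sup>2)" for n
  have "f \<longlonglongrightarrow> 2 / 9"
    unfolding f_def by real_asymp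
  then have "limsup (\<lambda>n. ereal (f n)) = ereal (2 / 9)"
    by (intro lim_imp_Limsup) auto
  moreover have "limsup (\<lambda>n. ereal (f n)) \<le> density C"
    unfolding density_def
  proof (intro Limsup_mono eventually_mono[OF eventually_gt_at_top[of 0]])
    fix n :: nat assume "0 < n"
    then obtain m where n: "n = Suc m"
      by (cases n) auto
    have "12 * real (card (Qbox m)) \<le> 54 * real (card (C \<inter> Qbox n))
        + 54 * (real (card (Qbox (Suc n))) - real (card (Qbox m)))"
      using card_code_Qbox_ge[OF assms, of m, folded n, THEN of_int_le_iff[where ?'a = real, THEN iffD2]]
      by simp
    then have "12 * (2 * real n - 1)\<^sup>2 - 54 * ((2 * real n + 3)\<^sup>2 - (2 * real n - 1)\<^sup>2)
        \<le> 54 * real (card (C \<inter> Qbox n))"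
      by (simp add: card_Qbox n algebra_simps)
    then have "f n \<le> 54 * real (card (C \<inter> Qbox n)) / (54 * (2 * real n + 1)\<^sup>2)"
      unfolding f_def by (rule divide_right_mono) simp
    then show "ereal (f n) \<le> ereal (real (card (C \<inter> Qbox n)) / real (card (Qbox n)))"
      by (simp add: card_Qbox add.commute)
  qed
  ultimately show ?thesis
    by simp
qed

subsection \<open>A code of density 2/9\<close>

definition in_pattern :: "int \<Rightarrow> int \<Rightarrow> bool" where
  "in_pattern i j \<longleftrightarrow> (i, j) \<in> set [(0, 1), (0, 5), (1, 3), (2, 0), (3, 2), (3, 4), (4, 0), (5, 3)]"

definition periodic_code :: "(int \<times> int) set" where
  "periodic_code = {(x, y). in_pattern (x mod 6) (y mod 6)}"

lemma periodic_code_add: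
  "(x + a, y + b) \<in> periodic_code \<longleftrightarrow> in_pattern ((x mod 6 + a) mod 6) ((y mod 6 + b) mod 6)"
  by (simp add: periodic_code_def mod_add_left_eq)

text \<open>By periodicity only the 36 residue pairs need checking; \<open>(a, b)\<close> is the
  offset to a codeword.\<close>

lemma pattern_covers:
  "\<forall>i \<in> set [0..5]. \<forall>j \<in> set [0..5]. \<exists>(a, b) \<in> set (grid 1). in_pattern ((i + a) mod 6) ((j + b) mod 6)"
  by code_simp

lemma pattern_separates:
  "\<forall>i \<in> set [0..5]. \<forall>j \<in> set [0..5]. \<forall>d \<in> set (grid 1). d \<noteq> (0, 0) \<longrightarrow>
     (\<exists>(a, b) \<in> set (grid 2). near (0, 0) (a, b) \<noteq> near d (a, b) \<and> in_pattern ((i + a) mod 6) ((j + b) mod 6))"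
  by code_simp

lemma periodic_code_identifying: "local_identifying_code periodic_code"
proof -
  have mod6: "x mod 6 \<in> set [0..5]" for x :: int
    by auto
  have cover: "I_set periodic_code (x, y) \<noteq> {}" for x y
  proof -
    obtain a b where "(a, b) \<in> set (grid 1)" "in_pattern ((x mod 6 + a) mod 6) ((y mod 6 + b) mod 6)"
      using pattern_covers mod6[of x] mod6[of y] by blast
    then have "(x + a, y + b) \<in> I_set periodic_code (x, y)"
      by (auto simp: I_set_eq periodic_code_add near_def set_grid)
    then show ?thesis
      by blast
  qed
  have separate: "I_set periodic_code (x, y) \<noteq> I_set periodic_code (z, w)" if adj: "king_adj (x, y) (z, w)" for x y z w
  proof -
    have "(z - x, w - y) \<in> set (grid 1)" "(z - x, w - y) \<noteq> (0, 0)"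
      using adj by (auto simp: king_adj_def set_grid)
    then obtain a b where ab: "near (0, 0) (a, b) \<noteq> near (z - x, w - y) (a, b)"
      "in_pattern ((x mod 6 + a) mod 6) ((y mod 6 + b) mod 6)"
      using pattern_separates mod6[of x] mod6[of y] by blast
    have "near (x, y) (x + a, y + b) \<longleftrightarrow> near (0, 0) (a, b)"
      "near (z, w) (x + a, y + b) \<longleftrightarrow> near (z - x, w - y) (a, b)"
      by (auto simp: near_def algebra_simps)
    moreover have "(x + a, y + b) \<in> periodic_code"
      using ab(2) by (simp add: periodic_code_add)
    ultimately show ?thesis
      using ab(1) unfolding I_set_eq by blast
  qed
  have "periodic_code \<noteq> {}"
    using cover by (auto simp: I_set_eq)
  then show ?thesis
    using cover separate by (simp add: local_identifying_code_def split_paired_All)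
qed

lemma card_periodic_code_Qbox_le: "real (card (periodic_code \<inter> Qbox n)) \<le> 8 * (real n / 3 + 2)\<^sup>2"
proof -
  define P where "P = {(i, j). in_pattern i j}"
  \<comment> \<open>Indices of the 6 x 6 blocks that meet the box in one direction;
    \<open>- int n div 6\<close> is the floor of -n/6.\<close>
  define M where "M = {- int n div 6..int n div 6}"
  have P: "P = set [(0, 1), (0, 5), (1, 3), (2, 0), (3, 2), (3, 4), (4, 0), (5, 3)]"
    by (auto simp: P_def in_pattern_def)
  have "periodic_code \<inter> Qbox n \<subseteq> (\<lambda>(p, q, i, j). (6 * p + i, 6 * q + j)) ` (M \<times> M \<times> P)"
  proof clarify
    fix x y assume "(x, y) \<in> periodic_code" "(x, y) \<in> Qbox n"
    then have "(x div 6, y div 6, x mod 6, y mod 6) \<in> M \<times> M \<times> P"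
      by (auto simp: M_def P_def periodic_code_def Qbox_def intro!: zdiv_mono1)
    then show "(x, y) \<in> (\<lambda>(p, q, i, j). (6 * p + i, 6 * q + j)) ` (M \<times> M \<times> P)"
      by (intro image_eqI[of _ _ "(x div 6, y div 6, x mod 6, y mod 6)"]) auto
  qed
  then have "card (periodic_code \<inter> Qbox n) \<le> card (M \<times> M \<times> P)"
    by (rule surj_card_le[rotated]) (simp add: M_def P)
  also have "\<dots> = 8 * (card M)\<^sup>2"
    by (simp add: card_cartesian_product P power2_eq_square)
  finally have "real (card (periodic_code \<inter> Qbox n)) \<le> 8 * (real (card M))\<^sup>2"
    by (metis (mono_tags) of_nat_le_iff of_nat_mult of_nat_numeral of_nat_power)
  moreover have "real (card M) \<le> real n / 3 + 2"
  proof -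
    have "int (card M) = int n div 6 - - int n div 6 + 1"
      by (simp add: M_def div_int_pos_iff)
    \<comment> \<open>Rounding down loses at most 5, so six times the number of blocks is at most n
      + (n + 5) + 6.\<close>
    moreover have "6 * (int n div 6) \<le> int n" "- int n - 5 \<le> 6 * (- int n div 6)"
      by linarith+
    ultimately have "6 * int (card M) \<le> 2 * int n + 11"
      by linarith
    then show ?thesis
      by linarith
  qed
  then have "(real (card M))\<^sup>2 \<le> (real n / 3 + 2)\<^sup>2"
    by (rule power_mono) simp
  ultimately show ?thesis
    by linarith
qed

lemma density_periodic_code_le: "density periodic_code \<le> ereal (2 / 9)"
proof -
  define f where "f n = 8 * (real n / 3 + 2)\<^sup>2 / (2 * real n + 1)\<^sup>2" for n
  have "f \<longlonglongrightarrow> 2 / 9"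
    unfolding f_def power2_eq_square by real_asymp
  then have "limsup (\<lambda>n. ereal (f n)) = ereal (2 / 9)"
    by (intro lim_imp_Limsup) auto
  moreover have "density periodic_code \<le> limsup (\<lambda>n. ereal (f n))"
    unfolding density_def
  proof (intro Limsup_mono always_eventually allI)
    fix n
    show "ereal (real (card (periodic_code \<inter> Qbox n)) / real (card (Qbox n))) \<le> ereal (f n)"
      using card_periodic_code_Qbox_le[of n]
      by (simp add: f_def card_Qbox divide_right_mono add.commute)
  qed
  ultimately show ?thesis
    by simp
qed

theorem mainTheorem18:
  shows "gamma_LID_king = ereal (2/9)
    \<and> (\<forall>C. local_identifying_code C \<longrightarrow> density C \<ge> ereal (2/9))
    \<and> (\<exists>C. local_identifying_code C \<and> density C = ereal (2/9))"
proof -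
  have density: "density periodic_code = ereal (2 / 9)"
    using density_periodic_code_le density_code_ge[OF periodic_code_identifying] by (rule antisym)
  have "gamma_LID_king = ereal (2 / 9)"
    unfolding gamma_LID_king_def
  proof (rule antisym)
    show "Inf {density C | C. local_identifying_code C} \<le> ereal (2 / 9)"
      using density periodic_code_identifying by (intro Inf_lower) (auto intro!: exI[of _ periodic_code])
    show "ereal (2 / 9) \<le> Inf {density C | C. local_identifying_code C}"
      using density_code_ge by (intro Inf_greatest) auto
  qed
  then show ?thesis
    using density density_code_ge periodic_code_identifying by blast
qed

end
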